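(* Let $a=1$, $b=-3$ and $c\in\{1/2,\,3/2\}$, and consider the planar system depending on the parameters $(\alpha,\varepsilon)\in\mathbb{R}^2$, $$\begin{cases}\dot x = ax+by+cxy-ax^2+\varepsilon y,\\ \dot y=(a+b)y-(2a+2b+c)xy+2cy^2+\alpha\,(y-x(1-x)).\end{cases}$$ At $\alpha=\varepsilon=0$ this system has two heteroclinic orbits between the saddles $(0,0)$ and $(1,0)$: the segment $\{(x,0):0<x<1\}$ and the parabola arc $\{(x,x(1-x)):0<x<1\}$. Then the splitting of both heteroclinic connections is regular, in the sense that the following Melnikov integrals are nonzero: (i) $M_\alpha(0)\neq 0$, where the Melnikov integral with respect to the parameter $p=\alpha$ (with $\varepsilon=0$) is evaluated along the heteroclinic orbit $\{(x,0):0<x<1\}$; (ii) $M_\varepsilon(0)\neq 0$, where the Melnikov integral with respect to the parameter $p=\varepsilon$ (with $\alpha=0$) is evaluated along the heteroclinic orbit $\{(x,x(1-x)):0<x<1\}$.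
   Context: For a smooth planar system $\dot x=f(x,y,p)$, $\dot y=g(x,y,p)$ depending on a parameter $p\in\mathbb{R}$, having at $p=0$ a heteroclinic solution $(x(t),y(t))$, $t\in\mathbb{R}$, the Melnikov integral with respect to $p$ along this solution is $$M_p(0)=\int_{-\infty}^{\infty}\varphi(t)\psi(t)\,dt,$$ where $$\varphi(t)=\exp\left[-\int_0^t\left(\frac{\partial f}{\partial x}+\frac{\partial g}{\partial y}\right)d\tau\right],\qquad \psi(t)=f\,\frac{\partial g}{\partial p}-g\,\frac{\partial f}{\partial p},$$ with all functions evaluated along the heteroclinic solution at $p=0$. The time parametrization of the heteroclinic solution may be fixed by requiring $x(0)=1/2$ (a different choice multiplies $M_p(0)$ by a positive constant). *)

theory Defs
  imports "HOL-Analysis.Analysis"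
begin

type_synonym planar_field = "real \<times> real \<Rightarrow> real \<times> real"

definition saddle :: "planar_field \<Rightarrow> real \<times> real \<Rightarrow> bool" where
  "saddle X P \<longleftrightarrow> X P = 0 \<and>
     (\<exists>D. (X has_derivative D) (at P) \<and>
        (\<exists>l m v w. l < 0 \<and> 0 < m \<and> v \<noteq> 0 \<and> w \<noteq> 0 \<and> D v = l *\<^sub>R v \<and> D w = m *\<^sub>R w))"

definition solution :: "planar_field \<Rightarrow> (real \<Rightarrow> real \<times> real) \<Rightarrow> bool" where
  "solution X z \<longleftrightarrow> (\<forall>t. (z has_vector_derivative X (z t)) (at t))"

text \<open>A heteroclinic solution between two distinct points may run in either direction.\<close>

definition heteroclinic_solution ::
  "planar_field \<Rightarrow> real \<times> real \<Rightarrow> real \<times> real \<Rightarrow> (real \<Rightarrow> real \<times> real) \<Rightarrow> bool" where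
  "heteroclinic_solution X P Q z \<longleftrightarrow> P \<noteq> Q \<and> solution X z \<and>
     ((z \<longlongrightarrow> P) at_bot \<and> (z \<longlongrightarrow> Q) at_top \<or>
      (z \<longlongrightarrow> Q) at_bot \<and> (z \<longlongrightarrow> P) at_top)"

definition heteroclinic_orbit ::
  "planar_field \<Rightarrow> real \<times> real \<Rightarrow> real \<times> real \<Rightarrow> (real \<times> real) set \<Rightarrow> bool" where
  "heteroclinic_orbit X P Q \<Gamma> \<longleftrightarrow> (\<exists>z. heteroclinic_solution X P Q z \<and> range z = \<Gamma>)"

text \<open>In the Melnikov integral the right-hand sides are functions \<open>f x y p\<close> and \<open>g x y p\<close>
  of the two phase variables and the parameter, and \<open>z t = (x t, y t)\<close> is a solution at \<open>p = 0\<close>.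
  The interval integral is oriented, so \<open>melnikov_phi\<close> is also correct for \<open>t < 0\<close>.\<close>

definition melnikov_phi ::
  "(real \<Rightarrow> real \<Rightarrow> real \<Rightarrow> real) \<Rightarrow> (real \<Rightarrow> real \<Rightarrow> real \<Rightarrow> real) \<Rightarrow>
   (real \<Rightarrow> real \<times> real) \<Rightarrow> real \<Rightarrow> real" where
  "melnikov_phi f g z t =
     exp (- (LBINT s=0..ereal t.
        deriv (\<lambda>u. f u (snd (z s)) 0) (fst (z s)) + deriv (\<lambda>v. g (fst (z s)) v 0) (snd (z s))))"

definition melnikov_psi ::
  "(real \<Rightarrow> real \<Rightarrow> real \<Rightarrow> real) \<Rightarrow> (real \<Rightarrow> real \<Rightarrow> real \<Rightarrow> real) \<Rightarrow>
   (real \<Rightarrow> real \<times> real) \<Rightarrow> real \<Rightarrow> real" where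
  "melnikov_psi f g z t =
     f (fst (z t)) (snd (z t)) 0 * deriv (\<lambda>p. g (fst (z t)) (snd (z t)) p) 0
     - g (fst (z t)) (snd (z t)) 0 * deriv (\<lambda>p. f (fst (z t)) (snd (z t)) p) 0"

definition melnikov_convergent ::
  "(real \<Rightarrow> real \<Rightarrow> real \<Rightarrow> real) \<Rightarrow> (real \<Rightarrow> real \<Rightarrow> real \<Rightarrow> real) \<Rightarrow>
   (real \<Rightarrow> real \<times> real) \<Rightarrow> bool" where
  "melnikov_convergent f g z \<longleftrightarrow>
     interval_lebesgue_integrable lborel (-\<infinity>) \<infinity> (\<lambda>t. melnikov_phi f g z t * melnikov_psi f g z t)"

definition melnikov_integral ::
  "(real \<Rightarrow> real \<Rightarrow> real \<Rightarrow> real) \<Rightarrow> (real \<Rightarrow> real \<Rightarrow> real \<Rightarrow> real) \<Rightarrow>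
   (real \<Rightarrow> real \<times> real) \<Rightarrow> real" where
  "melnikov_integral f g z = (LBINT t=-\<infinity>..\<infinity>. melnikov_phi f g z t * melnikov_psi f g z t)"

definition sys_f :: "real \<Rightarrow> real \<Rightarrow> real \<Rightarrow> real \<Rightarrow> real \<Rightarrow> real \<Rightarrow> real" where
  "sys_f a b c \<epsilon> x y = a * x + b * y + c * x * y - a * x\<^sup>2 + \<epsilon> * y"

definition sys_g :: "real \<Rightarrow> real \<Rightarrow> real \<Rightarrow> real \<Rightarrow> real \<Rightarrow> real \<Rightarrow> real" where
  "sys_g a b c \<alpha> x y =
     (a + b) * y - (2 * a + 2 * b + c) * x * y + 2 * c * y\<^sup>2 + \<alpha> * (y - x * (1 - x))"

definition sys :: "real \<Rightarrow> real \<Rightarrow> real \<Rightarrow> real \<Rightarrow> real \<Rightarrow> planar_field" where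
  "sys a b c \<alpha> \<epsilon> = (\<lambda>(x, y). (sys_f a b c \<epsilon> x y, sys_g a b c \<alpha> x y))"

definition segment_orbit :: "(real \<times> real) set" where
  "segment_orbit = {(x, 0) | x. 0 < x \<and> x < 1}"

definition parabola_orbit :: "(real \<times> real) set" where
  "parabola_orbit = {(x, x * (1 - x)) | x. 0 < x \<and> x < 1}"

end

(* Everything works for 0 < c < 2. On the segment x' = x (1 - x) and
   phi psi = - phi (x (1 - x))^2 is negative.

   On the parabola x' = - x (1 - x) (2 - c x) and psi = P (1 - 2 x) with
   P = x^2 (1 - x)^2 (2 - c x), so psi changes sign. After the substitution r = (2 - c) x / (2 - c x)
   the Melnikov integral is, up to a positive factor, the integral over 0 < r < 1 of
   r^(1/2) (1 - r)^B (1 - (4 - c) r / (2 - c)) with B = 1 / (2 - c). Subtracting a multiple of the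
   derivative of r^(3/2) (1 - r)^(B + 1) leaves an integrand of one sign; in the time variable
   this reads 3 phi psi = - (phi P)' - c x phi P, where phi P tends to 0 at both ends.

   Integrability follows in both cases from |phi psi| <= C |x'|, because phi x (1 - x) is bounded. *)

theory Submission
  imports Defs
begin

section \<open>Integrals over the line: strict positivity, domination, closed form of the
  exponential factor\<close>

text \<open>A nonnegative function with zero integral vanishes almost everywhere, which a positive
  one cannot do because Lebesgue measure is not zero.\<close>

lemma lborel_integral_pos:
  fixes h :: "real \<Rightarrow> real"
  assumes "integrable lborel h" and "\<And>t. 0 < h t"
  shows "0 < integral\<^sup>L lborel h"
proof -
  have "integral\<^sup>L lborel h \<noteq> 0"
  proof
    assume "integral\<^sup>L lborel h = 0"
    then have "AE t in lborel. h t = 0"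
      using assms by (subst (asm) integral_nonneg_eq_0_iff_AE) (auto simp: less_imp_le)
    then have "AE t in (lborel :: real measure). False"
      by (rule AE_mp) (simp add: less_imp_neq[OF assms(2), symmetric])
    then show False
      by (simp add: eventually_False ae_filter_eq_bot_iff)
  qed
  moreover have "0 \<le> integral\<^sup>L lborel h"
    using assms(2) by (intro integral_nonneg_AE AE_I2) (simp add: less_imp_le)
  ultimately show ?thesis by simp
qed

text \<open>A nonnegative \<open>v\<close> that is the derivative of a function with finite limits
  at both ends is integrable over the line, and it dominates \<open>h\<close>. For the Melnikov
  integrals \<open>x\<close> is the first coordinate of the orbit, up to sign.\<close>

lemma integrable_of_monotone_bound:
  fixes x v h :: "real \<Rightarrow> real"
  assumes der: "\<And>t. (x has_real_derivative v t) (at t)"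
    and cont: "continuous_on UNIV v" and nonneg: "\<And>t. 0 \<le> v t"
    and lim: "(x \<longlongrightarrow> l) at_bot" "(x \<longlongrightarrow> m) at_top"
    and meas: "continuous_on UNIV h" and bound: "\<And>t. \<bar>h t\<bar> \<le> C * v t"
  shows "integrable lborel h"
proof -
  have "set_integrable lborel (einterval (-\<infinity>) \<infinity>) v"
  proof (rule interval_integral_FTC_nonneg(1)[where F = x and A = l and B = m])
    show "((x \<circ> real_of_ereal) \<longlongrightarrow> l) (at_right (-\<infinity>))"
      using lim(1) by (simp add: ereal_tendsto_simps1)
    show "((x \<circ> real_of_ereal) \<longlongrightarrow> m) (at_left \<infinity>)"
      using lim(2) by (simp add: ereal_tendsto_simps1)
  qed (use assms in \<open>auto simp: continuous_on_eq_continuous_at\<close>)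
  then have "integrable lborel v"
    by (simp add: set_integrable_def)
  then have "integrable lborel (\<lambda>t. C * v t)" by simp
  then show ?thesis
  proof (rule Bochner_Integration.integrable_bound)
    show "h \<in> borel_measurable lborel"
      using meas by (simp add: borel_measurable_continuous_onI)
    show "AE t in lborel. norm (h t) \<le> norm (C * v t)"
      using order.trans[OF bound abs_ge_self] by simp
  qed
qed

text \<open>Evaluates \<open>melnikov_phi\<close> once an antiderivative \<open>L\<close> of the
  divergence along the orbit is known.\<close>

lemma exp_interval_integral_eq:
  fixes L D :: "real \<Rightarrow> real"
  assumes der: "\<And>t. (L has_real_derivative D t) (at t)" and cont: "continuous_on UNIV D"
  shows "exp (- (LBINT s=0..ereal t. D s)) = exp (L 0 - L t)"
proof -
  have "(LBINT s=ereal 0..ereal t. D s) = L t - L 0"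
    by (rule interval_integral_FTC_finite)
      (use assms in \<open>auto intro: continuous_on_subset has_vector_derivative_at_within
         simp: has_real_derivative_iff_has_vector_derivative\<close>)
  then show ?thesis by (simp add: zero_ereal_def)
qed

section \<open>The two saddles\<close>

lemma saddle_origin:
  fixes c :: real
  shows "saddle (sys 1 (-3) c 0 0) (0, 0)"
proof -
  have "(sys 1 (-3) c 0 0 has_derivative (\<lambda>h. (fst h - 3 * snd h, -2 * snd h))) (at (0, 0))"
    unfolding sys_def sys_f_def sys_g_def case_prod_unfold
    by (auto intro!: derivative_eq_intros simp: fun_eq_iff)
  then show ?thesis
    unfolding saddle_def
    by (intro conjI exI[of _ "\<lambda>h. (fst h - 3 * snd h, -2 * snd h)"] exI[of _ "-2"] exI[of _ 1]
         exI[of _ "(1,1)"] exI[of _ "(1,0)"])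
      (auto simp: sys_def sys_f_def sys_g_def zero_prod_def)
qed

lemma saddle_one:
  fixes c :: real
  assumes "c < 2"
  shows "saddle (sys 1 (-3) c 0 0) (1, 0)"
proof -
  \<comment> \<open>The linear part is upper triangular, so its eigenvalues are the diagonal entries
    -1 and \<open>2 - c\<close>; the second is positive because \<open>c < 2\<close>.\<close>
  have "(sys 1 (-3) c 0 0 has_derivative
      (\<lambda>h. (- fst h + (c - 3) * snd h, (2 - c) * snd h))) (at (1, 0))"
    unfolding sys_def sys_f_def sys_g_def case_prod_unfold
    by (auto intro!: derivative_eq_intros simp: fun_eq_iff algebra_simps)
  then show ?thesis
    unfolding saddle_def using assms
    by (intro conjI exI[of _ "\<lambda>h. (- fst h + (c - 3) * snd h, (2 - c) * snd h)"]
         exI[of _ "-1"] exI[of _ "2 - c"] exI[of _ "(1,0)"] exI[of _ "(1,-1)"])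
      (auto simp: sys_def sys_f_def sys_g_def zero_prod_def)
qed

section \<open>The logistic function and the segment orbit\<close>

text \<open>The logistic function: it solves x' = x (1 - x), the equation on the segment, and also
  serves as the chart from the line onto (0, 1) in which the flow on the parabola is
  integrated.\<close>

definition sigmoid :: "real \<Rightarrow> real" where
  "sigmoid u = 1 / (1 + exp (- u))"

lemma sigmoid_bounds: "0 < sigmoid u" "sigmoid u < 1"
  by (auto simp: sigmoid_def divide_simps add_pos_pos)

lemma sigmoid_deriv: "(sigmoid has_real_derivative sigmoid u * (1 - sigmoid u)) (at u)"
proof -
  have "1 + exp (- u) \<noteq> 0" by (metis add_pos_pos exp_gt_zero less_numeral_extra(1,3))
  then show ?thesis
    unfolding sigmoid_def
    by (auto intro!: derivative_eq_intros simp: field_simps power2_eq_square)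
qed

text \<open>The logit supplies the preimages that show that a solution runs through the whole
  orbit.\<close>

lemma sigmoid_ln:
  assumes "0 < x" "x < 1"
  shows "sigmoid (ln (x / (1 - x))) = x"
  using assms by (simp add: sigmoid_def exp_minus field_simps)

lemma sigmoid_at_top: "(sigmoid \<longlongrightarrow> 1) at_top"
proof -
  have "((\<lambda>u::real. exp (- u)) \<longlongrightarrow> 0) at_top"
    by (intro filterlim_compose[OF exp_at_bot] filterlim_uminus_at_bot_at_top)
  then have "((\<lambda>u::real. 1 / (1 + exp (- u))) \<longlongrightarrow> 1 / (1 + 0)) at_top"
    by (intro tendsto_intros) auto
  then show ?thesis by (simp add: sigmoid_def[abs_def])
qed

lemma sigmoid_at_bot: "(sigmoid \<longlongrightarrow> 0) at_bot"
proof -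
  have "sigmoid u = 1 - sigmoid (- u)" for u
    by (simp add: sigmoid_def exp_minus divide_simps add_pos_pos) (smt (verit) exp_gt_zero)
  then have eq: "sigmoid = (\<lambda>u. 1 - sigmoid (- u))" by (rule ext)
  have "((\<lambda>u. 1 - sigmoid (- u)) \<longlongrightarrow> 1 - 1) at_bot"
    by (intro tendsto_diff tendsto_const filterlim_compose[OF sigmoid_at_top]
        filterlim_uminus_at_top_at_bot)
  from this[folded eq] show ?thesis by simp
qed

lemma heteroclinic_orbit_segment:
  fixes c :: real
  shows "heteroclinic_orbit (sys 1 (-3) c 0 0) (0, 0) (1, 0) segment_orbit"
proof -
  define z where "z = (\<lambda>t. (sigmoid t, 0::real))"
  have "(z has_vector_derivative (sigmoid t * (1 - sigmoid t), 0)) (at t)" for t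
    unfolding z_def
    by (intro has_vector_derivative_Pair has_vector_derivative_const)
      (use sigmoid_deriv in \<open>simp add: has_real_derivative_iff_has_vector_derivative\<close>)
  then have "solution (sys 1 (-3) c 0 0) z"
    by (auto simp: solution_def sys_def sys_f_def sys_g_def z_def algebra_simps power2_eq_square)
  moreover have "(z \<longlongrightarrow> (0, 0)) at_bot" "(z \<longlongrightarrow> (1, 0)) at_top"
    unfolding z_def using sigmoid_at_bot sigmoid_at_top by (auto intro!: tendsto_Pair)
  moreover have "range z = segment_orbit"
    unfolding z_def segment_orbit_def using sigmoid_bounds
    by (auto simp: image_iff) (metis sigmoid_ln)
  ultimately show ?thesis
    by (auto simp: heteroclinic_orbit_def heteroclinic_solution_def)
qed

section \<open>The parabola orbit, integrated by inverting an explicit time function\<close>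

text \<open>In the coordinate \<open>u = ln (x / (1 - x))\<close> the flow on the parabola is
  \<open>u' = -(2 - c * sigmoid u)\<close>, so the solution passes \<open>u\<close> at time \<open>- clock c u\<close>, up to a
  constant.\<close>

definition clock :: "real \<Rightarrow> real \<Rightarrow> real" where
  "clock c u = u / 2 + c / (2 * (2 - c)) * ln (2 + (2 - c) * exp u)"

text \<open>With \<open>q = 2 + (2 - c) * exp u\<close> the reciprocal speed is
  \<open>(1 + exp u) / q\<close>, which splits into the constant 1/2 and a multiple of q'/q.\<close>

lemma clock_deriv:
  assumes "0 < c" "c < 2"
  shows "(clock c has_real_derivative 1 / (2 - c * sigmoid u)) (at u)"
proof -
  define q where "q = 2 + (2 - c) * exp u"
  have q: "q > 0" using assms by (simp add: q_def add_pos_pos)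
  have e: "1 + exp u > 0" by (simp add: add_pos_pos)
  have "sigmoid u = exp u / (1 + exp u)"
    using e by (simp add: sigmoid_def exp_minus field_simps)
  then have "2 - c * sigmoid u = q / (1 + exp u)"
    using e by (simp add: q_def field_simps)
  moreover have "1 / 2 + c / (2 * (2 - c)) * (((2 - c) * exp u) / q) = (1 + exp u) / q"
    using q assms by (simp add: field_simps) (simp add: q_def algebra_simps)
  moreover have "(clock c has_real_derivative
      1 / 2 + c / (2 * (2 - c)) * (((2 - c) * exp u) / q)) (at u)"
    unfolding clock_def q_def using q assms
    by (auto intro!: derivative_eq_intros simp: q_def mult.commute)
  ultimately show ?thesis by simp
qed

text \<open>A global solution of the autonomous equation for u is obtained by inverting its time
  function: \<open>clock c\<close> is strictly increasing and, by comparison with u / 2, maps onto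
  the whole line.\<close>

lemma clock_inverse:
  assumes c: "0 < c" "c < 2"
  obtains g where "\<And>u. g (clock c u) = u" "\<And>s. clock c (g s) = s"
    "\<And>s. (g has_real_derivative (2 - c * sigmoid (g s))) (at s)"
    "filterlim g at_top at_top" "filterlim g at_bot at_bot"
proof -
  have pos: "2 - c * sigmoid u > 0" for u
    using c sigmoid_bounds[of u] mult_strict_mono[of c 2 "sigmoid u" 1] by simp
  have mono: "strict_mono (clock c)"
    by (rule strict_monoI, rule DERIV_pos_imp_increasing) (use clock_deriv[OF c] pos in \<open>auto intro!: exI\<close>)
  have cont: "isCont (clock c) u" for u
    using clock_deriv[OF c] DERIV_isCont by blast
  have k: "c / (2 * (2 - c)) > 0" using c by simp
  have lower: "u / 2 \<le> clock c u" for u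
    unfolding clock_def using c k by (simp add: add_increasing2)
  have upper: "clock c u \<le> u / 2 + c / (2 * (2 - c)) * ln 4" if "u \<le> 0" for u
  proof -
    have "(2 - c) * exp u \<le> 2 * 1" using c that by (intro mult_mono) auto
    moreover have "0 < (2 - c) * exp u" using c by simp
    ultimately have "ln (2 + (2 - c) * exp u) \<le> ln 4" by (intro ln_mono) auto
    then show ?thesis unfolding clock_def using k by (intro add_left_mono mult_left_mono) auto
  qed
  have surj: "\<exists>u. clock c u = s" for s
  proof -
    define A where "A = c / (2 * (2 - c)) * ln (4::real)"
    have "A \<ge> 0" unfolding A_def using k by (intro mult_nonneg_nonneg) auto
    \<comment> \<open>At this argument the bound \<open>upper\<close> equals -(|s| + A) + A =
      -|s|.\<close>
    then have "clock c (- 2 * (\<bar>s\<bar> + A)) \<le> s"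
      using upper[of "- 2 * (\<bar>s\<bar> + A)"] unfolding A_def[symmetric]
      by (simp add: field_simps) linarith
    moreover have "s \<le> clock c (2 * \<bar>s\<bar>)" using lower[of "2 * \<bar>s\<bar>"] by auto
    ultimately show ?thesis
      using IVT[of "clock c" "- 2 * (\<bar>s\<bar> + A)" s "2 * \<bar>s\<bar>"] cont \<open>A \<ge> 0\<close> by force
  qed
  define g where "g = inv (clock c)"
  have g1: "g (clock c u) = u" for u
    unfolding g_def by (rule inv_f_f) (use mono strict_mono_imp_inj_on in blast)
  have g2: "clock c (g s) = s" for s
    unfolding g_def by (rule f_inv_into_f) (use surj in \<open>auto simp: image_iff eq_commute\<close>)
  have gmono: "s \<le> t \<Longrightarrow> g s \<le> g t" for s t
    by (metis g2 mono strict_mono_less_eq)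
  have gcont: "isCont g s" for s
    using isCont_inverse_function[of 1 "g s" g "clock c"] g1 g2 cont by auto
  have gder: "(g has_real_derivative (2 - c * sigmoid (g s))) (at s)" for s
  proof -
    have "(g has_real_derivative inverse (1 / (2 - c * sigmoid (g s)))) (at s)"
      by (rule DERIV_inverse_function[where f = "clock c" and a = "s - 1" and b = "s + 1"])
        (use clock_deriv[OF c] pos[of "g s"] g2 gcont in auto)
    then show ?thesis by simp
  qed
  \<comment> \<open>For a prescribed bound u the threshold is \<open>clock c u\<close>, since
    \<open>g\<close> is monotone and takes the value u there.\<close>
  have "filterlim g at_top at_top"
    unfolding filterlim_at_top eventually_at_top_linorder by (metis g1 gmono)
  moreover have "filterlim g at_bot at_bot"
    unfolding filterlim_at_bot eventually_at_bot_linorder by (metis g1 gmono)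
  ultimately show thesis using that g1 g2 gder by blast
qed

lemma heteroclinic_orbit_parabola:
  fixes c :: real
  assumes c: "0 < c" "c < 2"
  shows "heteroclinic_orbit (sys 1 (-3) c 0 0) (0, 0) (1, 0) parabola_orbit"
proof -
  obtain g where g1: "\<And>u. g (clock c u) = u"
    and gder: "\<And>s. (g has_real_derivative (2 - c * sigmoid (g s))) (at s)"
    and gtop: "filterlim g at_top at_top" and gbot: "filterlim g at_bot at_bot"
    using clock_inverse[OF c] by metis
  \<comment> \<open>Time is reversed because u decreases along the flow while \<open>g\<close>
    increases; the solution runs from (1, 0) to (0, 0).\<close>
  define x where "x = (\<lambda>t. sigmoid (g (- t)))"
  define z where "z = (\<lambda>t. (x t, x t * (1 - x t)))"
  have xder: "(x has_real_derivative - (x t * (1 - x t) * (2 - c * x t))) (at t)" for t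
  proof -
    have "((\<lambda>t. g (- t)) has_real_derivative (2 - c * sigmoid (g (- t))) * (-1)) (at t)"
      by (rule DERIV_chain2[OF gder]) (auto intro!: derivative_eq_intros)
    from DERIV_chain2[OF sigmoid_deriv this] show ?thesis
      by (simp add: x_def algebra_simps)
  qed
  have yder: "((\<lambda>t. x t * (1 - x t)) has_real_derivative
      (1 - 2 * x t) * - (x t * (1 - x t) * (2 - c * x t))) (at t)" for t
    by (auto intro!: derivative_eq_intros xder simp: algebra_simps)
  have "(z has_vector_derivative (- (x t * (1 - x t) * (2 - c * x t)),
       (1 - 2 * x t) * - (x t * (1 - x t) * (2 - c * x t)))) (at t)" for t
    unfolding z_def
    by (intro has_vector_derivative_Pair)
      (use xder yder in \<open>auto simp: has_real_derivative_iff_has_vector_derivative\<close>)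
  \<comment> \<open>Invariance of the parabola: on y = x (1 - x) the second component of the field
    is 1 - 2 x times the first.\<close>
  moreover have "sys 1 (-3) c 0 0 (z t) = (- (x t * (1 - x t) * (2 - c * x t)),
       (1 - 2 * x t) * - (x t * (1 - x t) * (2 - c * x t)))" for t
    by (simp add: sys_def sys_f_def sys_g_def z_def algebra_simps power2_eq_square)
  ultimately have "solution (sys 1 (-3) c 0 0) z"
    by (simp add: solution_def)
  moreover have "(x \<longlongrightarrow> 1) at_bot"
    unfolding x_def
    by (intro filterlim_compose[OF sigmoid_at_top] filterlim_compose[OF gtop]
        filterlim_uminus_at_top_at_bot)
  then have "(z \<longlongrightarrow> (1, 1 * (1 - 1))) at_bot"
    unfolding z_def by (intro tendsto_intros)
  then have "(z \<longlongrightarrow> (1, 0)) at_bot" by simp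
  moreover have "(x \<longlongrightarrow> 0) at_top"
    unfolding x_def
    by (intro filterlim_compose[OF sigmoid_at_bot] filterlim_compose[OF gbot]
        filterlim_uminus_at_bot_at_top)
  then have "(z \<longlongrightarrow> (0, 0 * (1 - 0))) at_top"
    unfolding z_def by (intro tendsto_intros)
  then have "(z \<longlongrightarrow> (0, 0)) at_top" by simp
  moreover have "range z = parabola_orbit"
  proof -
    have "\<exists>t. v = x t" if "0 < v" "v < 1" for v
      by (rule exI[of _ "- clock c (ln (v / (1 - v)))"])
        (use that in \<open>simp add: x_def g1 sigmoid_ln\<close>)
    moreover have "0 < x t" "x t < 1" for t
      using sigmoid_bounds by (auto simp: x_def)
    ultimately show ?thesis
      unfolding z_def parabola_orbit_def by (auto simp: image_iff)
  qed
  ultimately show ?thesis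
    by (auto simp: heteroclinic_orbit_def heteroclinic_solution_def)
qed

section \<open>The two Melnikov integrals\<close>

text \<open>Both orbits are graphs over the x-axis, so the first coordinate determines the solution.
  The unordered pair of limits leaves the direction open, as the definition does.\<close>

lemma heteroclinic_solution_fst:
  assumes z: "heteroclinic_solution X P Q z"
  shows "((\<lambda>t. fst (z t)) has_real_derivative fst (X (z t))) (at t)"
    and "\<exists>l m. ((\<lambda>t. fst (z t)) \<longlongrightarrow> l) at_bot \<and> ((\<lambda>t. fst (z t)) \<longlongrightarrow> m) at_top \<and>
      {l, m} = {fst P, fst Q}"
proof -
  show "((\<lambda>t. fst (z t)) has_real_derivative fst (X (z t))) (at t)"
    using z unfolding heteroclinic_solution_def solution_def
      has_real_derivative_iff_has_vector_derivative
    by (blast intro: bounded_linear.has_vector_derivative[OF bounded_linear_fst])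
  from z show "\<exists>l m. ((\<lambda>t. fst (z t)) \<longlongrightarrow> l) at_bot \<and> ((\<lambda>t. fst (z t)) \<longlongrightarrow> m) at_top \<and>
      {l, m} = {fst P, fst Q}"
    unfolding heteroclinic_solution_def by (blast dest: tendsto_fst)
qed

lemma melnikov_segment:
  fixes c :: real
  assumes c: "0 < c" "c < 2"
    and z: "heteroclinic_solution (sys 1 (-3) c 0 0) (0, 0) (1, 0) z"
    and range: "range z = segment_orbit"
  defines "f \<equiv> \<lambda>x y \<alpha>. sys_f 1 (-3) c 0 x y" and "g \<equiv> \<lambda>x y \<alpha>. sys_g 1 (-3) c \<alpha> x y"
  shows "melnikov_convergent f g z" "melnikov_integral f g z < 0"
proof -
  define x where "x = (\<lambda>t. fst (z t))"
  have x01: "0 < x t" "x t < 1" and snd0: "snd (z t) = 0" for t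
  proof -
    have "z t \<in> segment_orbit" using range by auto
    then show "0 < x t" "x t < 1" "snd (z t) = 0" by (auto simp: x_def segment_orbit_def)
  qed
  have zt: "z t = (x t, 0)" for t using snd0 by (simp add: x_def prod_eq_iff)
  obtain l m where lim: "(x \<longlongrightarrow> l) at_bot" "(x \<longlongrightarrow> m) at_top"
    using heteroclinic_solution_fst(2)[OF z] unfolding x_def by blast
  have xder: "(x has_real_derivative x t * (1 - x t)) (at t)" for t
    using heteroclinic_solution_fst(1)[OF z, of t]
    by (simp add: x_def[symmetric] zt sys_def sys_f_def algebra_simps power2_eq_square)
  have xcont: "continuous_on UNIV x"
    using xder by (auto intro!: continuous_at_imp_continuous_on DERIV_isCont)
  \<comment> \<open>Divided by x' = x (1 - x), the divergence -1 + (2 - c) x has the partial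
    fractions -1/x + (1 - c)/(1 - x); integrating in x gives \<open>L\<close>.\<close>
  define L where "L = (\<lambda>t. - ln (x t) - (1 - c) * ln (1 - x t))"
  have Lder: "(L has_real_derivative - 1 + (2 - c) * x t) (at t)" for t
  proof -
    have "((\<lambda>t. ln (x t)) has_real_derivative (1 - x t)) (at t)"
      by (rule DERIV_cong[OF DERIV_chain2[OF DERIV_ln xder]]) (use x01[of t] in auto)
    moreover have "((\<lambda>t. ln (1 - x t)) has_real_derivative - x t) (at t)"
      by (rule DERIV_cong[OF DERIV_chain2[OF DERIV_ln DERIV_diff[OF DERIV_const xder]]])
        (use x01[of t] in auto)
    ultimately have "(L has_real_derivative - (1 - x t) - (1 - c) * (- x t)) (at t)"
      unfolding L_def by (intro DERIV_diff DERIV_minus DERIV_cmult)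
    then show ?thesis by (simp add: algebra_simps)
  qed
  have Lcont: "continuous_on UNIV L"
    using Lder by (auto intro!: continuous_at_imp_continuous_on DERIV_isCont)
  have div: "deriv (\<lambda>u. f u (snd (z s)) 0) (fst (z s)) + deriv (\<lambda>v. g (fst (z s)) v 0) (snd (z s))
      = - 1 + (2 - c) * x s" for s
  proof -
    have "deriv (\<lambda>u. f u (snd (z s)) 0) (fst (z s)) = 1 - 2 * x s"
      by (rule DERIV_imp_deriv)
        (auto simp: zt f_def sys_f_def intro!: derivative_eq_intros)
    moreover have "deriv (\<lambda>v. g (fst (z s)) v 0) (snd (z s)) = -2 + (4 - c) * x s"
      by (rule DERIV_imp_deriv)
        (auto simp: zt g_def sys_g_def algebra_simps intro!: derivative_eq_intros)
    ultimately show ?thesis by (simp add: algebra_simps)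
  qed
  have phi: "melnikov_phi f g z t = exp (L 0 - L t)" for t
    unfolding melnikov_phi_def div
    by (rule exp_interval_integral_eq[OF Lder]) (intro continuous_intros xcont)
  have psi: "melnikov_psi f g z t = - (x t * (1 - x t))\<^sup>2" for t
  proof -
    have "deriv (\<lambda>p. g (fst (z t)) (snd (z t)) p) 0 = - (x t * (1 - x t))"
      by (rule DERIV_imp_deriv) (auto simp: zt g_def sys_g_def intro!: derivative_eq_intros)
    moreover have "f (fst (z t)) (snd (z t)) 0 = x t * (1 - x t)" "g (fst (z t)) (snd (z t)) 0 = 0"
      by (simp_all add: zt f_def g_def sys_f_def sys_g_def algebra_simps power2_eq_square)
    ultimately show ?thesis
      unfolding melnikov_psi_def by (simp add: power2_eq_square)
  qed
  define h where "h = (\<lambda>t. exp (L 0 - L t) * (x t * (1 - x t))\<^sup>2)"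
  have prod: "melnikov_phi f g z t * melnikov_psi f g z t = - h t" for t
    by (simp add: phi psi h_def)
  have hpos: "0 < h t" for t using x01[of t] by (simp add: h_def)
  have int: "integrable lborel h"
  proof (rule integrable_of_monotone_bound[OF xder _ _ lim])
    show "continuous_on UNIV (\<lambda>t. x t * (1 - x t))" "continuous_on UNIV h"
      unfolding h_def by (intro continuous_intros xcont Lcont)+
    show "0 \<le> x t * (1 - x t)" for t using x01[of t] by simp
    \<comment> \<open>One factor x (1 - x) is kept as x'. The other, times phi, is
      \<open>exp (L 0)\<close> times x^2 (1 - x)^(2 - c), where both powers are at most 1.\<close>
    show "\<bar>h t\<bar> \<le> exp (L 0) * (x t * (1 - x t))" for t
    proof -
      have "ln (x t) \<le> 0" "ln (1 - x t) \<le> 0" using x01[of t] by auto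
      then have "2 * ln (x t) + (2 - c) * ln (1 - x t) \<le> 0"
        using c by (intro add_nonpos_nonpos mult_nonneg_nonpos) auto
      then have "exp (L 0 - L t + ln (x t) + ln (1 - x t)) \<le> exp (L 0)"
        by (simp add: L_def algebra_simps)
      then have "exp (L 0 - L t) * (x t * (1 - x t)) \<le> exp (L 0)"
        using x01[of t] by (simp add: exp_add)
      then have "exp (L 0 - L t) * (x t * (1 - x t)) * (x t * (1 - x t))
          \<le> exp (L 0) * (x t * (1 - x t))"
        using x01[of t] by (intro mult_right_mono) auto
      then show ?thesis using hpos[of t] by (simp add: h_def power2_eq_square mult.assoc)
    qed
  qed
  show "melnikov_convergent f g z"
    unfolding melnikov_convergent_def prod interval_lebesgue_integrable_def
    using int by (simp add: set_integrable_def)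
  show "melnikov_integral f g z < 0"
    unfolding melnikov_integral_def prod interval_lebesgue_integral_def
    using lborel_integral_pos[OF int hpos] by (simp add: set_lebesgue_integral_def)
qed

text \<open>The change of sign of psi is absorbed by the exact derivative \<open>w\<close> of
  \<open>W\<close>, whose integral is zero; what remains is \<open>- (c / 3)\<close> times the
  integral of the positive function \<open>h\<close>.\<close>

lemma melnikov_parabola:
  fixes c :: real
  assumes c: "0 < c" "c < 2"
    and z: "heteroclinic_solution (sys 1 (-3) c 0 0) (0, 0) (1, 0) z"
    and range: "range z = parabola_orbit"
  defines "f \<equiv> \<lambda>x y \<epsilon>. sys_f 1 (-3) c \<epsilon> x y" and "g \<equiv> \<lambda>x y \<epsilon>. sys_g 1 (-3) c 0 x y"
  shows "melnikov_convergent f g z" "melnikov_integral f g z < 0"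
proof -
  define x where "x = (\<lambda>t. fst (z t))"
  have x01: "0 < x t" "x t < 1" and snd0: "snd (z t) = x t * (1 - x t)" for t
  proof -
    have "z t \<in> parabola_orbit" using range by auto
    then show "0 < x t" "x t < 1" "snd (z t) = x t * (1 - x t)"
      by (auto simp: x_def parabola_orbit_def)
  qed
  have zt: "z t = (x t, x t * (1 - x t))" for t using snd0 by (simp add: x_def prod_eq_iff)
  have q: "2 - c < 2 - c * x t" "2 - c * x t < 2" for t
    using c x01[of t] by auto
  then have q0: "0 < 2 - c * x t" for t using c by (smt (verit))
  obtain l m where lim: "(x \<longlongrightarrow> l) at_bot" "(x \<longlongrightarrow> m) at_top" and "{l, m} = {0, 1}"
    using heteroclinic_solution_fst(2)[OF z] unfolding x_def by auto
  \<comment> \<open>In this form the limits serve both directions of travel: x (1 - x) tends to 0 at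
    either end.\<close>
  then have lm: "l * (1 - l) = 0" "m * (1 - m) = 0" by (auto simp: doubleton_eq_iff)
  have xder: "(x has_real_derivative - (x t * (1 - x t) * (2 - c * x t))) (at t)" for t
  proof -
    have "fst (sys 1 (-3) c 0 0 (z t)) = - (x t * (1 - x t) * (2 - c * x t))"
      by (simp add: zt sys_def sys_f_def algebra_simps power2_eq_square)
    then show ?thesis
      using heteroclinic_solution_fst(1)[OF z, of t] by (simp add: x_def[symmetric])
  qed
  have xcont: "continuous_on UNIV x"
    using xder by (auto intro!: continuous_at_imp_continuous_on DERIV_isCont)
  \<comment> \<open>The exponent B of the substitution in r; it is also the ratio of the absolute
    values of the eigenvalues at (1, 0).\<close>
  define \<beta> where "\<beta> = 1 / (2 - c)"
  have \<beta>: "0 < \<beta>" "\<beta> * (2 - c) = 1" using c by (auto simp: \<beta>_def)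
  \<comment> \<open>\<open>L\<close> comes from the partial fractions of \<open>D / x'\<close> as a function of \<open>x\<close>.\<close>
  define L where "L = (\<lambda>t. 1/2 * ln (x t) + (1 - \<beta>) * ln (1 - x t) + (\<beta> + 7/2) * ln (2 - c * x t))"
  define D where "D = (\<lambda>t. - 1 + (2 - c) * x t + 5 * c * (x t * (1 - x t)))"
  have Lder: "(L has_real_derivative D t) (at t)" for t
  proof -
    have "((\<lambda>t. ln (x t)) has_real_derivative - ((1 - x t) * (2 - c * x t))) (at t)"
      by (rule DERIV_cong[OF DERIV_chain2[OF DERIV_ln xder]]) (use x01[of t] in auto)
    moreover have "((\<lambda>t. ln (1 - x t)) has_real_derivative x t * (2 - c * x t)) (at t)"
      by (rule DERIV_cong[OF DERIV_chain2[OF DERIV_ln DERIV_diff[OF DERIV_const xder]]])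
        (use x01[of t] in auto)
    moreover have "((\<lambda>t. ln (2 - c * x t)) has_real_derivative c * (x t * (1 - x t))) (at t)"
      by (rule DERIV_cong[OF DERIV_chain2[OF DERIV_ln
            DERIV_diff[OF DERIV_const DERIV_cmult[OF xder]]]])
        (use q0[of t] in auto)
    ultimately have "(L has_real_derivative 1/2 * - ((1 - x t) * (2 - c * x t))
        + (1 - \<beta>) * (x t * (2 - c * x t)) + (\<beta> + 7/2) * (c * (x t * (1 - x t)))) (at t)"
      unfolding L_def by (intro DERIV_add DERIV_cmult)
    moreover have "1/2 * - ((1 - x t) * (2 - c * x t))
        + (1 - \<beta>) * (x t * (2 - c * x t)) + (\<beta> + 7/2) * (c * (x t * (1 - x t)))
        = D t + x t * (1 - \<beta> * (2 - c))"
      by (simp add: D_def algebra_simps)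
    ultimately show ?thesis using \<beta> by simp
  qed
  have Lcont: "continuous_on UNIV L"
    using Lder by (auto intro!: continuous_at_imp_continuous_on DERIV_isCont)
  have div: "deriv (\<lambda>u. f u (snd (z s)) 0) (fst (z s)) + deriv (\<lambda>v. g (fst (z s)) v 0) (snd (z s))
      = D s" for s
  proof -
    have "deriv (\<lambda>u. f u (snd (z s)) 0) (fst (z s)) = 1 - 2 * x s + c * (x s * (1 - x s))"
      by (rule DERIV_imp_deriv)
        (auto simp: zt f_def sys_f_def intro!: derivative_eq_intros)
    moreover have "deriv (\<lambda>v. g (fst (z s)) v 0) (snd (z s))
        = -2 + (4 - c) * x s + 4 * c * (x s * (1 - x s))"
      by (rule DERIV_imp_deriv)
        (auto simp: zt g_def sys_g_def algebra_simps intro!: derivative_eq_intros)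
    ultimately show ?thesis by (simp add: D_def algebra_simps)
  qed
  define \<phi> where "\<phi> = (\<lambda>t. exp (L 0 - L t))"
  have phi: "melnikov_phi f g z t = \<phi> t" for t
    unfolding melnikov_phi_def div \<phi>_def
    by (rule exp_interval_integral_eq[OF Lder]) (unfold D_def, intro continuous_intros xcont)
  have \<phi>cont: "continuous_on UNIV \<phi>"
    unfolding \<phi>_def by (intro continuous_intros Lcont)
  have \<phi>der: "(\<phi> has_real_derivative - D t * \<phi> t) (at t)" for t
    unfolding \<phi>_def by (auto intro!: derivative_eq_intros Lder)
  have \<phi>pos: "0 < \<phi> t" for t by (simp add: \<phi>_def)
  define P where "P = (\<lambda>t. (x t * (1 - x t))\<^sup>2 * (2 - c * x t))"
  have Ppos: "0 < P t" for t using x01[of t] q0[of t] by (simp add: P_def)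
  have Pcont: "continuous_on UNIV P"
    unfolding P_def by (intro continuous_intros xcont)
  have psi: "melnikov_psi f g z t = P t * (1 - 2 * x t)" for t
  proof -
    have "deriv (\<lambda>p. f (fst (z t)) (snd (z t)) p) 0 = x t * (1 - x t)"
      by (rule DERIV_imp_deriv) (auto simp: zt f_def sys_f_def intro!: derivative_eq_intros)
    moreover have "deriv (\<lambda>p. g (fst (z t)) (snd (z t)) p) 0 = 0"
      by (simp add: g_def)
    moreover have "g (fst (z t)) (snd (z t)) 0 = - (x t * (1 - x t) * (1 - 2 * x t) * (2 - c * x t))"
      by (simp add: zt g_def sys_g_def algebra_simps power2_eq_square)
    ultimately show ?thesis
      unfolding melnikov_psi_def by (simp add: P_def power2_eq_square)
  qed
  \<comment> \<open>The product of \<open>\<phi>\<close> and x (1 - x) is \<open>exp (L 0)\<close>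
    times x^(1/2) (1 - x)^\<beta> (2 - c x)^(-(\<beta> + 7/2)). The first two powers are at most 1,
    and the last is bounded because 2 - c x exceeds 2 - c.\<close>
  define C where "C = exp (L 0 + (\<beta> + 7/2) * \<bar>ln (2 - c)\<bar>)"
  have bound: "\<phi> t * (x t * (1 - x t)) \<le> C" for t
  proof -
    have "ln (x t) \<le> 0" "ln (1 - x t) \<le> 0" using x01[of t] by auto
    then have "ln (x t) / 2 + \<beta> * ln (1 - x t) \<le> 0"
      using \<beta> by (intro add_nonpos_nonpos mult_nonneg_nonpos) auto
    moreover have "- ln (2 - c * x t) \<le> \<bar>ln (2 - c)\<bar>"
      using ln_mono[of "2 - c" "2 - c * x t"] q(1)[of t] q0[of t] c by linarith
    then have "(\<beta> + 7/2) * - ln (2 - c * x t) \<le> (\<beta> + 7/2) * \<bar>ln (2 - c)\<bar>"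
      using \<beta> by (intro mult_left_mono) auto
    ultimately have "L 0 - L t + ln (x t) + ln (1 - x t) \<le> L 0 + (\<beta> + 7/2) * \<bar>ln (2 - c)\<bar>"
      by (simp add: L_def algebra_simps)
    then have "exp (L 0 - L t + ln (x t) + ln (1 - x t)) \<le> C" unfolding C_def by simp
    then show ?thesis using x01[of t] by (simp add: exp_add \<phi>_def)
  qed
  have Pbound: "\<phi> t * P t \<le> C * (x t * (1 - x t) * (2 - c * x t))" for t
  proof -
    have "\<phi> t * (x t * (1 - x t)) * (x t * (1 - x t) * (2 - c * x t))
        \<le> C * (x t * (1 - x t) * (2 - c * x t))"
      using bound[of t] x01[of t] q0[of t] by (intro mult_right_mono) auto
    then show ?thesis by (simp add: P_def power2_eq_square mult_ac)
  qed
  \<comment> \<open>The bounded weight \<open>k\<close> lets one estimate cover both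
    \<open>w\<close> and \<open>h\<close>; the increasing function is -x, since x decreases along
    the orbit.\<close>
  have int: "integrable lborel (\<lambda>t. \<phi> t * P t * k (x t))"
    if "continuous_on UNIV (\<lambda>t. k (x t))" and k: "\<And>t. \<bar>k (x t)\<bar> \<le> B" for k :: "real \<Rightarrow> real" and B
  proof (rule integrable_of_monotone_bound)
    show "((\<lambda>t. - x t) has_real_derivative x t * (1 - x t) * (2 - c * x t)) (at t)" for t
      using DERIV_minus[OF xder[of t]] by simp
    show "continuous_on UNIV (\<lambda>t. x t * (1 - x t) * (2 - c * x t))"
      "continuous_on UNIV (\<lambda>t. \<phi> t * P t * k (x t))"
      by (intro continuous_intros xcont \<phi>cont Pcont that(1))+
    show "0 \<le> x t * (1 - x t) * (2 - c * x t)" for t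
      using x01[of t] q0[of t] by simp
    show "((\<lambda>t. - x t) \<longlongrightarrow> - l) at_bot" "((\<lambda>t. - x t) \<longlongrightarrow> - m) at_top"
      using lim by (auto intro: tendsto_minus)
    show "\<bar>\<phi> t * P t * k (x t)\<bar> \<le> C * B * (x t * (1 - x t) * (2 - c * x t))" for t
    proof -
      have "\<bar>\<phi> t * P t * k (x t)\<bar> = \<phi> t * P t * \<bar>k (x t)\<bar>"
        using \<phi>pos[of t] Ppos[of t] by (simp add: abs_mult)
      also have "\<dots> \<le> C * (x t * (1 - x t) * (2 - c * x t)) * B"
      proof (rule mult_mono[OF Pbound k])
        show "0 \<le> C * (x t * (1 - x t) * (2 - c * x t))"
          by (rule order.trans[OF _ Pbound]) (use \<phi>pos[of t] Ppos[of t] in simp)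
      qed simp
      finally show ?thesis by (simp add: mult_ac)
    qed
  qed
  define W where "W = (\<lambda>t. \<phi> t * P t)"
  define w where "w = (\<lambda>t. \<phi> t * P t * (6 * x t - 3 - c * x t))"
  have Wder: "(W has_real_derivative w t) (at t)" for t
  proof -
    have "((\<lambda>t. \<phi> t * ((y t)\<^sup>2 * q t)) has_real_derivative
        \<phi> t * ((2 * y t * y') * q t + q' * (y t)\<^sup>2) + - D t * \<phi> t * ((y t)\<^sup>2 * q t)) (at t)"
      if "(y has_real_derivative y') (at t)" "(q has_real_derivative q') (at t)" for y q y' q'
      using that by (auto intro!: derivative_eq_intros \<phi>der)
    moreover have "((\<lambda>t. x t * (1 - x t)) has_real_derivative
        - (x t * (1 - x t) * (2 - c * x t)) * (1 - 2 * x t)) (at t)"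
      by (auto intro!: derivative_eq_intros xder simp: algebra_simps)
    moreover have "((\<lambda>t. 2 - c * x t) has_real_derivative
        c * (x t * (1 - x t) * (2 - c * x t))) (at t)"
      by (auto intro!: derivative_eq_intros xder simp: algebra_simps)
    ultimately have "(W has_real_derivative \<phi> t *
        ((2 * (x t * (1 - x t)) * (- (x t * (1 - x t) * (2 - c * x t)) * (1 - 2 * x t))) *
          (2 - c * x t) + c * (x t * (1 - x t) * (2 - c * x t)) * (x t * (1 - x t))\<^sup>2)
        + - D t * \<phi> t * ((x t * (1 - x t))\<^sup>2 * (2 - c * x t))) (at t)"
      unfolding W_def P_def by blast
    \<comment> \<open>Here \<open>p\<close>, \<open>y\<close>, \<open>q\<close>, \<open>s\<close>,
      \<open>d\<close> stand for \<open>\<phi>\<close>, x (1 - x), 2 - c x, 1 - 2 x and the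
      divergence. The bracket on the right is the logarithmic derivative of \<open>W\<close>: c y
      comes from q'/q, -2 s q from 2 y'/y, and -d from \<open>\<phi>\<close>.\<close>
    moreover have "p * ((2 * y * (- (y * q) * s)) * q + c * (y * q) * y\<^sup>2) + - d * p * (y\<^sup>2 * q)
        = p * (y\<^sup>2 * q) * (c * y - 2 * s * q - d)" for p y q s d :: real
      by (simp add: algebra_simps power2_eq_square)
    \<comment> \<open>The quadratic terms cancel, leaving -3 (1 - 2 x) - c x; its first term
      reproduces psi after multiplication by \<open>P\<close>, and its second has one sign.\<close>
    moreover have "c * (x t * (1 - x t)) - 2 * (1 - 2 * x t) * (2 - c * x t) - D t
        = 6 * x t - 3 - c * x t"
      by (simp add: D_def algebra_simps)
    ultimately show ?thesis by (simp only: w_def P_def)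
  qed
  \<comment> \<open>\<open>Pbound\<close> squeezes \<open>W\<close> between 0 and a multiple of the
    speed, which vanishes at both saddles.\<close>
  have Wlim: "(W \<longlongrightarrow> 0) F" if "(x \<longlongrightarrow> n) F" "n * (1 - n) = 0" for n F
  proof (rule tendsto_sandwich[where f = "\<lambda>_. 0"])
    have "((\<lambda>t. C * (x t * (1 - x t) * (2 - c * x t))) \<longlongrightarrow> C * (n * (1 - n) * (2 - c * n))) F"
      by (intro tendsto_intros that)
    then show "((\<lambda>t. C * (x t * (1 - x t) * (2 - c * x t))) \<longlongrightarrow> 0) F" using that by simp
    show "\<forall>\<^sub>F t in F. 0 \<le> W t"
      using \<phi>pos Ppos by (auto simp: W_def less_imp_le)
    show "\<forall>\<^sub>F t in F. W t \<le> C * (x t * (1 - x t) * (2 - c * x t))"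
      using Pbound by (auto simp: W_def)
  qed auto
  have wint: "integrable lborel w"
    unfolding w_def
  proof (rule int[where B = "9 + c" and k = "\<lambda>u. 6 * u - 3 - c * u"])
    show "\<bar>6 * x t - 3 - c * x t\<bar> \<le> 9 + c" for t
      using x01[of t] q[of t] c by linarith
  qed (intro continuous_intros xcont)
  have "(LBINT t=-\<infinity>..\<infinity>. w t) = 0 - 0"
  proof (rule interval_integral_FTC_integrable[where F = W])
    show "((W \<circ> real_of_ereal) \<longlongrightarrow> 0) (at_right (-\<infinity>))"
      using Wlim[OF lim(1) lm(1)] by (simp add: ereal_tendsto_simps1)
    show "((W \<circ> real_of_ereal) \<longlongrightarrow> 0) (at_left \<infinity>)"
      using Wlim[OF lim(2) lm(2)] by (simp add: ereal_tendsto_simps1)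
    have "continuous_on UNIV w"
      unfolding w_def by (intro continuous_intros xcont \<phi>cont Pcont)
    then show "isCont w t" for t by (simp add: continuous_on_eq_continuous_at)
    show "set_integrable lborel (einterval (-\<infinity>) \<infinity>) w"
      using wint by (simp add: set_integrable_def)
  qed (use Wder in \<open>auto simp: has_real_derivative_iff_has_vector_derivative\<close>)
  then have w0: "integral\<^sup>L lborel w = 0"
    by (simp add: interval_lebesgue_integral_def set_lebesgue_integral_def)
  define h where "h = (\<lambda>t. \<phi> t * P t * x t)"
  have hint: "integrable lborel h"
    unfolding h_def by (rule int[where B = 1 and k = "\<lambda>u. u"]) (use x01 xcont in \<open>auto simp: less_imp_le\<close>)
  have hpos: "0 < h t" for t using \<phi>pos[of t] Ppos[of t] x01[of t] by (simp add: h_def)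
  have prod: "melnikov_phi f g z t * melnikov_psi f g z t = - (1/3) * w t - c / 3 * h t" for t
    by (simp add: phi psi w_def h_def field_simps)
  show "melnikov_convergent f g z"
    unfolding melnikov_convergent_def prod interval_lebesgue_integrable_def
    using wint hint by (simp add: set_integrable_def)
  have "melnikov_integral f g z = - (c / 3) * integral\<^sup>L lborel h"
    unfolding melnikov_integral_def prod interval_lebesgue_integral_def
    using wint hint w0 by (simp add: set_lebesgue_integral_def)
  then show "melnikov_integral f g z < 0"
    using lborel_integral_pos[OF hint hpos] c by simp
qed

theorem mainTheorem2:
  fixes a b c :: real
  assumes "a = 1" and "b = -3" and "c \<in> {1/2, 3/2}"
  shows "saddle (sys a b c 0 0) (0, 0) \<and> saddle (sys a b c 0 0) (1, 0) \<and>
    heteroclinic_orbit (sys a b c 0 0) (0, 0) (1, 0) segment_orbit \<and>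
    heteroclinic_orbit (sys a b c 0 0) (0, 0) (1, 0) parabola_orbit \<and>
    (\<forall>z. heteroclinic_solution (sys a b c 0 0) (0, 0) (1, 0) z \<and>
         range z = segment_orbit \<and> fst (z 0) = 1/2 \<longrightarrow>
       melnikov_convergent (\<lambda>x y \<alpha>. sys_f a b c 0 x y) (\<lambda>x y \<alpha>. sys_g a b c \<alpha> x y) z \<and>
       melnikov_integral (\<lambda>x y \<alpha>. sys_f a b c 0 x y) (\<lambda>x y \<alpha>. sys_g a b c \<alpha> x y) z \<noteq> 0) \<and>
    (\<forall>z. heteroclinic_solution (sys a b c 0 0) (0, 0) (1, 0) z \<and>
         range z = parabola_orbit \<and> fst (z 0) = 1/2 \<longrightarrow>
       melnikov_convergent (\<lambda>x y \<epsilon>. sys_f a b c \<epsilon> x y) (\<lambda>x y \<epsilon>. sys_g a b c 0 x y) z \<and>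
       melnikov_integral (\<lambda>x y \<epsilon>. sys_f a b c \<epsilon> x y) (\<lambda>x y \<epsilon>. sys_g a b c 0 x y) z \<noteq> 0)"
proof -
  have c: "0 < c" "c < 2" using assms(3) by auto
  show ?thesis
    unfolding assms(1,2)
    by (intro conjI allI impI; (elim conjE)?)
      (rule saddle_origin saddle_one[OF c(2)] heteroclinic_orbit_segment
        heteroclinic_orbit_parabola[OF c] melnikov_segment(1)[OF c] melnikov_parabola(1)[OF c]
        less_imp_neq[OF melnikov_segment(2)[OF c]] less_imp_neq[OF melnikov_parabola(2)[OF c]];
        assumption)+
qed

end
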